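(* For any vertex algebra $V$ and any $V$-module $W$, we have $$E_1(W)=C_2(W),\qquad E_2(W)=C_3(W).$$
   Context: Vector spaces are over $\mathbb{C}$. For a vertex algebra $V$ and a $V$-module $W$, write $v_n$ ($v\in V$, $n\in\mathbb{Z}$) for the modes of $v$ acting on $W$: $Y_W(v,x)=\sum_{n\in\mathbb{Z}}v_nx^{-n-1}$. For $n\in\mathbb{Z}$, $E_n(W)$ is the linear span of the vectors $u^{(1)}_{-1-k_1}\cdots u^{(r)}_{-1-k_r}w$ for $r\ge 1$, $u^{(1)},\dots,u^{(r)}\in V$, $w\in W$, $k_1,\dots,k_r\ge 0$ with $k_1+\cdots+k_r\ge n$. For $n\ge 2$, $C_n(W)$ is the linear span of the vectors $v_{-n}w$ for $v\in V$, $w\in W$. *)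

theory Defs
  imports Complex_Main "HOL-Library.Groups_Big_Fun"
begin

text \<open>
  A vertex operator map is given by its modes: \<open>Y u n w\<close> stands for \<open>u\<^sub>n w\<close>, the coefficient of
  \<open>x\<close> to the power \<open>-n-1\<close> in \<open>Y(u,x)w\<close>. The next predicate says that \<open>Y\<close> is a linear map from
  \<open>V\<close> to \<open>Hom(W, W((x)))\<close>: the modes are bilinear and \<open>Y(u,x)w\<close> has only finitely many terms with
  negative powers of \<open>x\<close>.
\<close>

definition vertex_operator_map ::
  "(complex \<Rightarrow> 'v::ab_group_add \<Rightarrow> 'v) \<Rightarrow> (complex \<Rightarrow> 'w::ab_group_add \<Rightarrow> 'w) \<Rightarrow>
    ('v \<Rightarrow> int \<Rightarrow> 'w \<Rightarrow> 'w) \<Rightarrow> bool" where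
  "vertex_operator_map sV sW Y \<longleftrightarrow>
    (\<forall>n w. Vector_Spaces.linear sV sW (\<lambda>u. Y u n w)) \<and>
    (\<forall>u n. Vector_Spaces.linear sW sW (Y u n)) \<and>
    (\<forall>u w. \<exists>N. \<forall>n\<ge>N. Y u n w = 0)"

text \<open>
  The Jacobi identity
  \<open>x\<^sub>0\<^sup>-\<^sup>1 \<delta>((x\<^sub>1-x\<^sub>2)/x\<^sub>0) Y\<^sub>W(u,x\<^sub>1)Y\<^sub>W(v,x\<^sub>2)w - x\<^sub>0\<^sup>-\<^sup>1 \<delta>((x\<^sub>2-x\<^sub>1)/(-x\<^sub>0)) Y\<^sub>W(v,x\<^sub>2)Y\<^sub>W(u,x\<^sub>1)w
    = x\<^sub>2\<^sup>-\<^sup>1 \<delta>((x\<^sub>1-x\<^sub>0)/x\<^sub>2) Y\<^sub>W(Y(u,x\<^sub>0)v,x\<^sub>2)w\<close>,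
  written out coefficientwise: the equation for \<open>l, m, n\<close> compares the coefficients of
  \<open>x\<^sub>0\<close> to the \<open>-l-1\<close>, \<open>x\<^sub>1\<close> to the \<open>-m-1\<close>, \<open>x\<^sub>2\<close> to the \<open>-n-1\<close>. All sums over \<open>i\<close> have finite support
  when \<open>Y\<close> and \<open>YW\<close> satisfy the truncation condition, so \<open>Sum_any\<close> is the actual sum.
\<close>

definition jacobi_identity ::
  "('v \<Rightarrow> int \<Rightarrow> 'v \<Rightarrow> 'v) \<Rightarrow> (complex \<Rightarrow> 'w::ab_group_add \<Rightarrow> 'w) \<Rightarrow>
    ('v \<Rightarrow> int \<Rightarrow> 'w \<Rightarrow> 'w) \<Rightarrow> bool" where
  "jacobi_identity Y sW YW \<longleftrightarrow>
    (\<forall>u v w l m n.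
      Sum_any (\<lambda>i::nat. sW ((-1) ^ i * (of_int l gchoose i))
          (YW u (m + l - int i) (YW v (n + int i) w)
            - sW ((-1) powi l) (YW v (n + l - int i) (YW u (m + int i) w))))
      = Sum_any (\<lambda>i::nat. sW (of_int m gchoose i) (YW (Y u (l + int i) v) (m + n - int i) w)))"

locale vertex_algebra = vector_space scale
  for scale :: "complex \<Rightarrow> 'v::ab_group_add \<Rightarrow> 'v" +
  fixes Y :: "'v \<Rightarrow> int \<Rightarrow> 'v \<Rightarrow> 'v"
    and vac :: 'v
  assumes vertex_operator_map: "vertex_operator_map scale scale Y"
    and vacuum: "Y vac n v = (if n = -1 then v else 0)"
    and creation_regular: "n \<ge> 0 \<Longrightarrow> Y v n vac = 0"
    and creation: "Y v (-1) vac = v"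
    and jacobi: "jacobi_identity Y scale Y"

locale vertex_algebra_module =
  V: vertex_algebra scaleV Y vac + W: vector_space scaleW
  for scaleV :: "complex \<Rightarrow> 'v::ab_group_add \<Rightarrow> 'v"
    and Y :: "'v \<Rightarrow> int \<Rightarrow> 'v \<Rightarrow> 'v"
    and vac :: 'v
    and scaleW :: "complex \<Rightarrow> 'w::ab_group_add \<Rightarrow> 'w" +
  fixes YW :: "'v \<Rightarrow> int \<Rightarrow> 'w \<Rightarrow> 'w"
  assumes module_vertex_operator_map: "vertex_operator_map scaleV scaleW YW"
    and module_vacuum: "YW vac n w = (if n = -1 then w else 0)"
    and module_jacobi: "jacobi_identity Y scaleW YW"

text \<open>
  The list \<open>[(u\<^sub>1, k\<^sub>1), \<dots>, (u\<^sub>r, k\<^sub>r)]\<close> encodes the operator product whose \<open>j\<close>-th factor is the mode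
  of \<open>u\<^sub>j\<close> with index \<open>-1-k\<^sub>j\<close>; the head of the list acts last.
\<close>

definition E_subspace ::
  "(complex \<Rightarrow> 'w::ab_group_add \<Rightarrow> 'w) \<Rightarrow> ('v \<Rightarrow> int \<Rightarrow> 'w \<Rightarrow> 'w) \<Rightarrow> int \<Rightarrow> 'w set" where
  "E_subspace sW YW n = module.span sW
    {foldr (\<lambda>(u, k). YW u (- 1 - int k)) uks w | (uks :: ('v \<times> nat) list) w.
      length uks \<ge> 1 \<and> int (sum_list (map snd uks)) \<ge> n}"

text \<open>Only meaningful for \<open>n \<ge> 2\<close>.\<close>

definition C_subspace ::
  "(complex \<Rightarrow> 'w::ab_group_add \<Rightarrow> 'w) \<Rightarrow> ('v \<Rightarrow> int \<Rightarrow> 'w \<Rightarrow> 'w) \<Rightarrow> nat \<Rightarrow> 'w set" where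
  "C_subspace sW YW n = module.span sW {YW v (- int n) w | v w. True}"

end

theory Submission imports Defs begin

text \<open>
  The commutator formula moves the modes \<open>u\<^sub>-\<^sub>1\<^sub>-\<^sub>k\<close> past \<open>v\<^sub>-\<^sub>n\<close> at the cost of modes of index
  below \<open>-n\<close>, which lie in \<open>C\<^sub>n(W)\<close> because \<open>v\<^sub>-\<^sub>n\<^sub>-\<^sub>k\<close> is a multiple of
  \<open>(v\<^sub>-\<^sub>1\<^sub>-\<^sub>k vac)\<^sub>-\<^sub>n\<close>. Hence \<open>C\<^sub>n(W)\<close> is stable under all \<open>u\<^sub>-\<^sub>1\<^sub>-\<^sub>k\<close>, and
  one factor with \<open>k \<ge> n - 1\<close> puts a product into \<open>C\<^sub>n(W)\<close>. For \<open>E\<^sub>2(W)\<close> it remains to treat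
  \<open>u\<^sub>-\<^sub>2 v\<^sub>-\<^sub>2 w\<close>, which is isolated by the expansion of \<open>(u\<^sub>-\<^sub>1 v)\<^sub>-\<^sub>3 w\<close>: every other term
  lies in \<open>C\<^sub>3(W)\<close>.
\<close>

section \<open>Sums with values in a subspace\<close>

lemma (in module) subspace_Sum_any:
  assumes "subspace S" "\<And>i. f i \<in> S"
  shows "Sum_any f \<in> S"
  using assms by (auto simp: Sum_any.expand_set intro: subspace_sum)

lemma (in module) subspace_Sum_any_isolate:
  assumes S: "subspace S" and fin: "finite {i. f i \<noteq> 0}"
    and total: "Sum_any f \<in> S" and others: "\<And>i. i \<noteq> j \<Longrightarrow> f i \<in> S"
  shows "f j \<in> S"
proof -
  \<comment> \<open>The index \<open>j\<close> is inserted since \<open>f j\<close> may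
    vanish.\<close>
  let ?A = "insert j {i. f i \<noteq> 0}"
  have "Sum_any f = sum f ?A"
    using fin by (intro Sum_any.expand_superset) blast+
  also have "\<dots> = f j + sum f (?A - {j})"
    using fin by (intro sum.remove) simp_all
  finally have "f j = Sum_any f - sum f (?A - {j})"
    by (simp only: add_diff_cancel_right')
  moreover have "sum f (?A - {j}) \<in> S"
    using others by (intro subspace_sum[OF S]) blast
  ultimately show ?thesis
    using subspace_diff[OF S total] by (simp only:)
qed

text \<open>Upper negation gives \<open>(k + i) choose i\<close> up to sign. This permits dividing
  by the coefficient in \<open>mode_mem_C\<close>.\<close>

lemma gbinomial_minus_Suc_neq_0: "(- of_nat (Suc k) :: complex) gchoose i \<noteq> 0"
proof -
  have "(of_nat (Suc k) + of_nat i - 1 :: complex) = of_nat (k + i)"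
    by simp
  then have "(- of_nat (Suc k) :: complex) gchoose i = (- 1) ^ i * of_nat ((k + i) choose i)"
    by (simp only: gbinomial_minus[of "of_nat (Suc k)"] binomial_gbinomial)
  moreover have "(of_nat ((k + i) choose i) :: complex) \<noteq> 0"
    by (simp only: of_nat_eq_0_iff binomial_eq_0_iff)
  ultimately show ?thesis
    by (simp only: mult_eq_0_iff) simp
qed

section \<open>The Jacobi identity modulo a subspace\<close>

context vertex_algebra_module
begin

lemma linear_mode: "Vector_Spaces.linear scaleW scaleW (YW u n)"
  using module_vertex_operator_map unfolding vertex_operator_map_def by blast

lemma mode_zero [simp]: "YW u n 0 = 0"
proof -
  interpret L: Vector_Spaces.linear scaleW scaleW "YW u n" by (rule linear_mode)
  show ?thesis by (rule L.zero)
qed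

lemma truncation: obtains N where "\<And>n. n \<ge> N \<Longrightarrow> YW u n w = 0"
  using module_vertex_operator_map unfolding vertex_operator_map_def by blast

lemma jacobiW:
  "Sum_any (\<lambda>i::nat. scaleW ((-1) ^ i * (of_int l gchoose i))
      (YW u (m + l - int i) (YW v (n + int i) w)
        - scaleW ((-1) powi l) (YW v (n + l - int i) (YW u (m + int i) w))))
   = Sum_any (\<lambda>i::nat. scaleW (of_int m gchoose i) (YW (Y u (l + int i) v) (m + n - int i) w))"
  using module_jacobi unfolding jacobi_identity_def by blast

text \<open>By truncation both inner modes, \<open>YW v (n + int i) w\<close> and
  \<open>YW u (m + int i) w\<close>, vanish for large \<open>i\<close>.\<close>

lemma finite_jacobi_support:
  "finite {i. scaleW ((-1) ^ i * (of_int l gchoose i))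
      (YW u (m + l - int i) (YW v (n + int i) w)
        - scaleW ((-1) powi l) (YW v (n + l - int i) (YW u (m + int i) w))) \<noteq> 0}"
proof -
  obtain M where M: "\<And>k. k \<ge> M \<Longrightarrow> YW u k w = 0" using truncation by blast
  obtain N where N: "\<And>k. k \<ge> N \<Longrightarrow> YW v k w = 0" using truncation by blast
  have "YW u (m + int i) w = 0 \<and> YW v (n + int i) w = 0" if "\<not> i \<le> nat (max (M - m) (N - n))" for i
    using that by (intro conjI M N) linarith+
  then show ?thesis
    by (intro finite_subset[OF _ finite_atMost[of "nat (max (M - m) (N - n))"]] subsetI)
      (rule ccontr, simp del: nat_le_iff)
qed

lemma jacobi_isolate:
  assumes S: "W.subspace S"
    and rhs: "\<And>i. scaleW (of_int m gchoose i) (YW (Y u (l + int i) v) (m + n - int i) w) \<in> S"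
    and others: "\<And>i. i \<noteq> j \<Longrightarrow> scaleW ((-1) ^ i * (of_int l gchoose i))
      (YW u (m + l - int i) (YW v (n + int i) w)
        - scaleW ((-1) powi l) (YW v (n + l - int i) (YW u (m + int i) w))) \<in> S"
  shows "scaleW ((-1) ^ j * (of_int l gchoose j))
      (YW u (m + l - int j) (YW v (n + int j) w)
        - scaleW ((-1) powi l) (YW v (n + l - int j) (YW u (m + int j) w))) \<in> S"
    (is "?f j \<in> S")
proof -
  have "Sum_any ?f \<in> S"
    unfolding jacobiW by (rule W.subspace_Sum_any[OF S rhs])
  with S finite_jacobi_support show ?thesis
    by (rule W.subspace_Sum_any_isolate[where f = ?f]) (rule others)
qed

lemma subspace_scale_cancel:
  assumes "W.subspace S" "scaleW c w \<in> S" "c \<noteq> 0"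
  shows "w \<in> S"
  using W.subspace_scale[OF assms(1,2), of "inverse c"] assms(3) by simp

text \<open>For \<open>l = 0\<close> the factor \<open>0 gchoose i\<close> leaves only
  \<open>i = 0\<close> on the left of the Jacobi identity, which is the commutator.\<close>

lemma commutator_mem:
  assumes S: "W.subspace S" and "\<And>i. YW (Y u (int i) v) (m + n - int i) w \<in> S"
  shows "YW u m (YW v n w) - YW v n (YW u m w) \<in> S"
proof -
  have "scaleW ((-1) ^ 0 * (of_int 0 gchoose 0))
      (YW u (m + 0 - int 0) (YW v (n + int 0) w)
        - scaleW ((-1) powi 0) (YW v (n + 0 - int 0) (YW u (m + int 0) w))) \<in> S"
    by (rule jacobi_isolate[OF S])
      (use assms in \<open>auto simp: gbinomial_0_left intro: W.subspace_scale W.subspace_0\<close>)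
  then show ?thesis
    by simp
qed

section \<open>Action of modes on the subspaces \<open>C n\<close>\<close>

abbreviation C :: "nat \<Rightarrow> 'w set" where
  "C \<equiv> C_subspace scaleW YW"

abbreviation E :: "int \<Rightarrow> 'w set" where
  "E \<equiv> E_subspace scaleW YW"

lemma subspace_C: "W.subspace (C n)"
  unfolding C_subspace_def by (rule W.subspace_span)

lemma mode_C_mem:
  assumes x: "x \<in> C k" and S: "W.subspace S" and gen: "\<And>v w. YW u m (YW v (- int k) w) \<in> S"
  shows "YW u m x \<in> S"
proof -
  interpret L: Vector_Spaces.linear scaleW scaleW "YW u m" by (rule linear_mode)
  have "W.subspace (YW u m -` S)"
    using S by (rule L.subspace_vimage)
  then have "C k \<subseteq> YW u m -` S"
    unfolding C_subspace_def using gen by (intro W.span_minimal) auto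
  then show ?thesis
    using x by auto
qed

lemma mode_mem_C:
  assumes "1 \<le> n" "m \<le> - int n"
  shows "YW v m w \<in> C n"
proof -
  define k where "k = nat (- int n - m)"
  have m: "m = - int n - int k"
    using assms by (simp add: k_def)
  let ?l = "- 1 - int k"
  \<comment> \<open>In the Jacobi identity for \<open>v\<close> and \<open>vac\<close> at indices
    \<open>?l, 0, - int n\<close>, this is the only \<open>i\<close> for which a vacuum mode on the
    left has index -1; the factor beside it is the mode of index \<open>?l - int ?j = m\<close>. On
    the right only \<open>i = 0\<close> survives.\<close>
  let ?j = "n - 1"
  have "scaleW ((-1) ^ ?j * (of_int ?l gchoose ?j))
      (YW v (0 + ?l - int ?j) (YW vac (- int n + int ?j) w)
        - scaleW ((-1) powi ?l) (YW vac (- int n + ?l - int ?j) (YW v (0 + int ?j) w))) \<in> C n"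
  proof (rule jacobi_isolate[OF subspace_C])
    fix i
    show "scaleW (of_int 0 gchoose i) (YW (Y v (?l + int i) vac) (0 + - int n - int i) w) \<in> C n"
      by (cases i) (auto simp: gbinomial_0_left C_subspace_def intro: W.span_base W.span_zero)
  qed (use assms subspace_C in \<open>auto simp: module_vacuum intro: W.subspace_0\<close>)
  moreover have "(0 + ?l - int ?j) = m" "- int n + int ?j = - 1" "- int n + ?l - int ?j \<noteq> - 1"
    using assms m by auto
  ultimately have "scaleW ((-1) ^ ?j * (of_int ?l gchoose ?j)) (YW v m w) \<in> C n"
    by (simp add: module_vacuum)
  moreover have "(of_int ?l gchoose ?j :: complex) \<noteq> 0"
    using gbinomial_minus_Suc_neq_0[of k ?j] by simp
  ultimately show ?thesis
    using subspace_scale_cancel[OF subspace_C] by fastforce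
qed

lemma mode_C_stable:
  assumes "1 \<le> n" "m \<le> - 1" "x \<in> C n"
  shows "YW u m x \<in> C n"
proof -
  have "YW u m (YW v (- int n) w) \<in> C n" for v w
  proof -
    \<comment> \<open>The correction terms have index \<open>m - int n - int i\<close>, which is
      below \<open>- int n\<close> because \<open>m\<close> is negative.\<close>
    have "YW u m (YW v (- int n) w) - YW v (- int n) (YW u m w) \<in> C n"
      using assms by (intro commutator_mem subspace_C mode_mem_C) auto
    moreover have "YW v (- int n) (YW u m w) \<in> C n"
      using assms by (intro mode_mem_C) auto
    ultimately show ?thesis
      using W.subspace_add[OF subspace_C] by fastforce
  qed
  then show ?thesis
    by (rule mode_C_mem[OF assms(3) subspace_C])
qed

lemma mode_C2:
  assumes "x \<in> C 2"
  shows "YW u (- 2) x \<in> C 3"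
proof -
  have "YW u (- 2) (YW v (- 2) w) \<in> C 3" for v w
  proof -
    \<comment> \<open>Indices \<open>l = -1\<close>, \<open>m = 0\<close>, \<open>n = -3\<close>:
      the right side is \<open>(u_{-1} v)_{-3} w\<close>, and the left side is the sum over
      \<open>i\<close> of \<open>u_{-1-i} v_{-3+i} w + v_{-4-i} u_i w\<close>. The wanted product
      occurs at \<open>i = 1\<close>.\<close>
    have "scaleW ((-1) ^ 1 * (of_int (- 1) gchoose 1))
      (YW u (0 + - 1 - int 1) (YW v (- 3 + int 1) w)
        - scaleW ((-1) powi (- 1)) (YW v (- 3 + - 1 - int 1) (YW u (0 + int 1) w))) \<in> C 3"
    proof (rule jacobi_isolate[OF subspace_C])
      fix i :: nat
      show "scaleW (of_int 0 gchoose i) (YW (Y u (- 1 + int i) v) (0 + - 3 - int i) w) \<in> C 3"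
        by (intro W.subspace_scale[OF subspace_C] mode_mem_C) auto
    next
      fix i :: nat
      assume "i \<noteq> 1"
      then consider "i = 0" | "i \<ge> 2" by linarith
      then have "YW u (0 + - 1 - int i) (YW v (- 3 + int i) w) \<in> C 3"
      proof cases
        case 1
        then show ?thesis by (intro mode_C_stable mode_mem_C) auto
      next
        case 2
        then show ?thesis by (intro mode_mem_C) auto
      qed
      then show "scaleW ((-1) ^ i * (of_int (- 1) gchoose i))
        (YW u (0 + - 1 - int i) (YW v (- 3 + int i) w)
          - scaleW ((-1) powi (- 1)) (YW v (- 3 + - 1 - int i) (YW u (0 + int i) w))) \<in> C 3"
        by (rule W.subspace_scale[OF subspace_C W.subspace_diff[OF subspace_C]])
          (intro W.subspace_scale[OF subspace_C] mode_mem_C, auto)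
    qed
    then have "YW u (- 2) (YW v (- 2) w) + YW v (- 5) (YW u 1 w) \<in> C 3"
      by simp
    moreover have "YW v (- 5) (YW u 1 w) \<in> C 3"
      by (rule mode_mem_C) auto
    ultimately show ?thesis
      using W.subspace_diff[OF subspace_C] by fastforce
  qed
  then show ?thesis
    by (intro mode_C_mem[OF assms subspace_C]) simp
qed

section \<open>Products of modes and the two equalities\<close>

lemma product_mem_C2:
  assumes "sum_list (map snd uks) \<ge> 1"
  shows "foldr (\<lambda>(u, k). YW u (- 1 - int k)) uks w \<in> C 2"
  using assms
proof (induction uks)
  case (Cons p uks)
  obtain u k where p: "p = (u, k)" by fastforce
  show ?case
  proof (cases "k = 0")
    case True
    then show ?thesis
      using Cons by (simp add: p mode_C_stable)
  qed (simp add: p mode_mem_C)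
qed simp

text \<open>Induction on the outermost factor: \<open>k = 0\<close> preserves \<open>C 3\<close>,
  \<open>k \<ge> 2\<close> lands there directly, and for \<open>k = 1\<close> the remaining factors
  have weight at least 1, so they give an element of \<open>C 2\<close>, which
  \<open>mode_C2\<close> sends into \<open>C 3\<close>.\<close>

lemma product_mem_C3:
  assumes "sum_list (map snd uks) \<ge> 2"
  shows "foldr (\<lambda>(u, k). YW u (- 1 - int k)) uks w \<in> C 3"
  using assms
proof (induction uks)
  case (Cons p uks)
  obtain u k where p: "p = (u, k)" by fastforce
  consider "k = 0" | "k = 1" | "k \<ge> 2" by linarith
  then show ?case
  proof cases
    case 1
    then show ?thesis
      using Cons by (simp add: p mode_C_stable)
  next
    case 2
    then show ?thesis
      using mode_C2[OF product_mem_C2] Cons.prems by (simp add: p)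
  next
    case 3
    then show ?thesis
      by (simp add: p mode_mem_C)
  qed
qed simp

lemma C_subset_E: "C (Suc n) \<subseteq> E (int n)"
  unfolding C_subspace_def E_subspace_def
proof (rule W.span_mono, clarify)
  fix v w
  show "\<exists>uks w'. YW v (- int (Suc n)) w = foldr (\<lambda>(u, k). YW u (- 1 - int k)) uks w' \<and>
      1 \<le> length uks \<and> int n \<le> int (sum_list (map snd uks))"
    by (rule exI[of _ "[(v, n)]"], rule exI[of _ w]) (simp add: algebra_simps)
qed

lemma E1_eq_C2: "E 1 = C 2"
proof
  show "E 1 \<subseteq> C 2"
    unfolding E_subspace_def
    by (rule W.span_minimal[OF _ subspace_C]) (auto intro!: product_mem_C2)
  show "C 2 \<subseteq> E 1"
    using C_subset_E[of 1] by (simp add: numeral_2_eq_2)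
qed

lemma E2_eq_C3: "E 2 = C 3"
proof
  show "E 2 \<subseteq> C 3"
    unfolding E_subspace_def
    by (rule W.span_minimal[OF _ subspace_C]) (auto intro!: product_mem_C3)
  show "C 3 \<subseteq> E 2"
    using C_subset_E[of 2] by (simp add: numeral_3_eq_3)
qed

end

theorem corollary3p6:
  fixes scaleV :: "complex \<Rightarrow> 'v::ab_group_add \<Rightarrow> 'v"
    and Y :: "'v \<Rightarrow> int \<Rightarrow> 'v \<Rightarrow> 'v"
    and vac :: 'v
    and scaleW :: "complex \<Rightarrow> 'w::ab_group_add \<Rightarrow> 'w"
    and YW :: "'v \<Rightarrow> int \<Rightarrow> 'w \<Rightarrow> 'w"
  assumes "vertex_algebra_module scaleV Y vac scaleW YW"
  shows "E_subspace scaleW YW 1 = C_subspace scaleW YW 2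
    \<and> E_subspace scaleW YW 2 = C_subspace scaleW YW 3"
proof -
  interpret vertex_algebra_module scaleV Y vac scaleW YW by fact
  show ?thesis
    using E1_eq_C2 E2_eq_C3 by blast
qed

end
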